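(* Let $\mathcal T=(V,E)$ be a directed tree and let $S_{\boldsymbol\lambda}$ be a weighted shift on $\mathcal T$ with weights $\boldsymbol\lambda=\{\lambda_v\}_{v\in V^\circ}\subseteq\mathbb C$. Then $S_{\boldsymbol\lambda}$ is unitarily equivalent to the weighted shift $S_{|\boldsymbol\lambda|}$ on $\mathcal T$ with weights $|\boldsymbol\lambda|=\{|\lambda_v|\}_{v\in V^\circ}$.
   Context: A directed tree $\mathcal T=(V,E)$ consists of a nonempty set $V$ (of arbitrary cardinality) of vertices and a set $E\subseteq V\times V\setminus\{(v,v):v\in V\}$ of edges such that: (1) any two distinct vertices $u,v$ are joined by an undirected path, i.e. there are $v_1=u,\dots,v_n=v$ in $V$ ($n\ge 2$) with $(v_j,v_{j+1})\in E$ or $(v_{j+1},v_j)\in E$ for each $j<n$; (2) there is no circuit, i.e. no finite sequence of distinct vertices $u_1,\dots,u_n$ ($n\ge2$) with $(u_j,u_{j+1})\in E$ for $j<n$ and $(u_n,u_1)\in E$; (3) every vertex $v$ that is not a root has a unique vertex $\operatorname{par}(v)$ (its parent) with $(\operatorname{par}(v),v)\in E$; a root is a vertex $v$ for which there is no $u$ with $(u,v)\in E$. A directed tree has at most one root, denoted $\mathrm{root}$ when it exists. $V^\circ$ is $V$ with the root removed (and $V^\circ=V$ if $\mathcal T$ has no root). $\ell^2(V)$ is the Hilbert space of square summable complex functions on $V$. For $\boldsymbol\lambda=\{\lambda_v\}_{v\in V^\circ}\subseteq\mathbb C$ and $f\colon V\to\mathbb C$ put $(\Lambda f)(v)=\lambda_v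 f(\operatorname{par}(v))$ for $v\in V^\circ$ and $(\Lambda f)(\mathrm{root})=0$. The weighted shift $S_{\boldsymbol\lambda}$ is the (possibly unbounded, not necessarily densely defined) operator in $\ell^2(V)$ with domain $\mathcal D(S_{\boldsymbol\lambda})=\{f\in\ell^2(V):\Lambda f\in\ell^2(V)\}$ and $S_{\boldsymbol\lambda}f=\Lambda f$. *)

theory Defs
  imports "HOL-Analysis.Analysis"
begin

definition is_root :: "'v set \<Rightarrow> ('v \<times> 'v) set \<Rightarrow> 'v \<Rightarrow> bool" where
  "is_root V E v \<longleftrightarrow> v \<in> V \<and> \<not> (\<exists>u\<in>V. (u, v) \<in> E)"

definition undirected_path :: "'v set \<Rightarrow> ('v \<times> 'v) set \<Rightarrow> 'v \<Rightarrow> 'v list \<Rightarrow> 'v \<Rightarrow> bool" where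
  "undirected_path V E u vs v \<longleftrightarrow>
     length vs \<ge> 2 \<and> set vs \<subseteq> V \<and> hd vs = u \<and> last vs = v \<and>
     (\<forall>j. Suc j < length vs \<longrightarrow> (vs ! j, vs ! Suc j) \<in> E \<or> (vs ! Suc j, vs ! j) \<in> E)"

definition circuit :: "'v set \<Rightarrow> ('v \<times> 'v) set \<Rightarrow> 'v list \<Rightarrow> bool" where
  "circuit V E us \<longleftrightarrow>
     length us \<ge> 2 \<and> set us \<subseteq> V \<and> distinct us \<and>
     (\<forall>j. Suc j < length us \<longrightarrow> (us ! j, us ! Suc j) \<in> E) \<and> (last us, hd us) \<in> E"

locale directed_tree =
  fixes V :: "'v set" and E :: "('v \<times> 'v) set"
  assumes nonempty: "V \<noteq> {}"
    and edges: "E \<subseteq> V \<times> V - {(v, v) | v. v \<in> V}"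
    and connected: "\<And>u v. u \<in> V \<Longrightarrow> v \<in> V \<Longrightarrow> u \<noteq> v \<Longrightarrow> \<exists>vs. undirected_path V E u vs v"
    and no_circuit: "\<not> (\<exists>us. circuit V E us)"
    and unique_parent: "\<And>v. v \<in> V \<Longrightarrow> \<not> is_root V E v \<Longrightarrow> \<exists>!u. u \<in> V \<and> (u, v) \<in> E"

definition par :: "'v set \<Rightarrow> ('v \<times> 'v) set \<Rightarrow> 'v \<Rightarrow> 'v" where
  "par V E v = (THE u. u \<in> V \<and> (u, v) \<in> E)"

definition nonroots :: "'v set \<Rightarrow> ('v \<times> 'v) set \<Rightarrow> 'v set" where
  "nonroots V E = V - {v. is_root V E v}"

text \<open>A function on \<open>V\<close> is represented by its extension by zero to the whole type.\<close>

definition ell2 :: "'v set \<Rightarrow> ('v \<Rightarrow> complex) set" where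
  "ell2 V = {f. (\<forall>v. v \<notin> V \<longrightarrow> f v = 0) \<and> (\<lambda>v. (cmod (f v))\<^sup>2) summable_on V}"

definition ell2_inner :: "'v set \<Rightarrow> ('v \<Rightarrow> complex) \<Rightarrow> ('v \<Rightarrow> complex) \<Rightarrow> complex" where
  "ell2_inner V f g = (\<Sum>\<^sub>\<infinity>v\<in>V. f v * cnj (g v))"

text \<open>The sum in the inner product does converge, so \<open>infsum\<close> never takes its default value.\<close>

lemma ell2_inner_summable:
  assumes "f \<in> ell2 V" and "g \<in> ell2 V"
  shows "(\<lambda>v. f v * cnj (g v)) summable_on V"
proof (rule abs_summable_summable, rule abs_summable_product)
  show "(\<lambda>v. norm (f v * f v)) summable_on V"
    using assms by (simp add: ell2_def norm_mult power2_eq_square)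
  show "(\<lambda>v. norm (cnj (g v) * cnj (g v))) summable_on V"
    using assms by (simp add: ell2_def norm_mult power2_eq_square)
qed

text \<open>A possibly unbounded operator: a domain together with an action. The values of
  \<open>act\<close> outside \<open>dom_of\<close> carry no meaning.\<close>

record 'v l2_operator =
  dom_of :: "('v \<Rightarrow> complex) set"
  act :: "('v \<Rightarrow> complex) \<Rightarrow> ('v \<Rightarrow> complex)"

definition shift_map ::
  "'v set \<Rightarrow> ('v \<times> 'v) set \<Rightarrow> ('v \<Rightarrow> complex) \<Rightarrow> ('v \<Rightarrow> complex) \<Rightarrow> ('v \<Rightarrow> complex)" where
  "shift_map V E w f = (\<lambda>v. if v \<in> nonroots V E then w v * f (par V E v) else 0)"

text \<open>Only the values of the weights \<open>w\<close> on \<open>nonroots V E\<close> matter.\<close>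

definition weighted_shift ::
  "'v set \<Rightarrow> ('v \<times> 'v) set \<Rightarrow> ('v \<Rightarrow> complex) \<Rightarrow> 'v l2_operator" where
  "weighted_shift V E w =
     \<lparr>dom_of = {f \<in> ell2 V. shift_map V E w f \<in> ell2 V}, act = shift_map V E w\<rparr>"

definition unitary_map ::
  "'v set \<Rightarrow> 'w set \<Rightarrow> (('v \<Rightarrow> complex) \<Rightarrow> ('w \<Rightarrow> complex)) \<Rightarrow> bool" where
  "unitary_map V W U \<longleftrightarrow>
     bij_betw U (ell2 V) (ell2 W) \<and>
     (\<forall>f\<in>ell2 V. \<forall>g\<in>ell2 V. U (\<lambda>v. f v + g v) = (\<lambda>x. U f x + U g x)) \<and>
     (\<forall>c. \<forall>f\<in>ell2 V. U (\<lambda>v. c * f v) = (\<lambda>x. c * U f x)) \<and>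
     (\<forall>f\<in>ell2 V. \<forall>g\<in>ell2 V. ell2_inner W (U f) (U g) = ell2_inner V f g)"

text \<open>\<open>U A = B U\<close> as an equality of unbounded operators, i.e. including their domains.\<close>

definition unitarily_equivalent ::
  "'v set \<Rightarrow> 'v l2_operator \<Rightarrow> 'w set \<Rightarrow> 'w l2_operator \<Rightarrow> bool" where
  "unitarily_equivalent V A W B \<longleftrightarrow>
     (\<exists>U. unitary_map V W U \<and> U ` dom_of A = dom_of B \<and>
          (\<forall>f\<in>dom_of A. U (act A f) = act B (U f)))"

end

(* Multiplication by a unimodular function b on V is unitary, and it intertwines the two shifts as
   soon as b v * w v = |w v| * b (par v) for every non-root v. Fix a base vertex x0. By connectedness
   every vertex v has a common ancestor with x0, so b v can be defined by multiplying the inverse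
   phases of the weights along the ancestral line of v up to it and dividing by those along the line
   of x0. The choice of the common ancestor is immaterial because there is no circuit. *)
theory Submission
  imports Defs
begin

section \<open>Products along the orbits of a self-map\<close>

lemma prod_orbit_add:
  fixes c :: "'a \<Rightarrow> 'b::comm_monoid_mult"
  shows "(\<Prod>i<m + n. c ((p ^^ i) x)) =
    (\<Prod>i<m. c ((p ^^ i) x)) * (\<Prod>i<n. c ((p ^^ i) ((p ^^ m) x)))"
proof (induction n)
  case (Suc n)
  have "(p ^^ n) ((p ^^ m) x) = (p ^^ (m + n)) x"
    by (metis add.commute comp_apply funpow_add)
  with Suc show ?case
    by (simp add: mult.assoc)
qed simp

lemma funpow_closed: "(\<And>x. x \<in> V \<Longrightarrow> p x \<in> V) \<Longrightarrow> x \<in> V \<Longrightarrow> (p ^^ n) x \<in> V"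
  by (induction n) auto

lemma funpow_fixed: "p x = x \<Longrightarrow> (p ^^ n) x = x"
  by (induction n) auto

text \<open>If m \<le> n, the orbit returns after \<open>d = n - m\<close> steps to
  \<open>y = (p ^^ m) x\<close>. For \<open>d > 0\<close>, \<open>periodic\<close> makes
  \<open>y\<close> a fixed point with \<open>c y = 1\<close>, so all the extra factors are
  1.\<close>

lemma prod_orbit_eq:
  fixes c :: "'a \<Rightarrow> 'b::comm_monoid_mult"
  assumes closed: "\<And>x. x \<in> V \<Longrightarrow> p x \<in> V"
    and periodic: "\<And>x k. x \<in> V \<Longrightarrow> 0 < k \<Longrightarrow> (p ^^ k) x = x \<Longrightarrow> p x = x \<and> c x = 1"
    and "x \<in> V" and "(p ^^ m) x = (p ^^ n) x"
  shows "(\<Prod>i<m. c ((p ^^ i) x)) = (\<Prod>i<n. c ((p ^^ i) x))"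
  using assms(4)
proof (induction m n rule: linorder_wlog)
  case (le m n)
  obtain d where n: "n = m + d"
    using le(1) nat_le_iff_add by blast
  define y where "y = (p ^^ m) x"
  have "y \<in> V"
    unfolding y_def using closed \<open>x \<in> V\<close> by (rule funpow_closed)
  have fix_y: "(p ^^ d) y = y"
    using le(2) by (metis n y_def add.commute comp_apply funpow_add)
  have "(\<Prod>i<d. c ((p ^^ i) y)) = 1"
  proof (cases "d = 0")
    case False
    then have "p y = y" "c y = 1"
      using periodic[OF \<open>y \<in> V\<close> _ fix_y] by auto
    then show ?thesis
      by (simp add: funpow_fixed)
  qed simp
  then show ?case
    unfolding n prod_orbit_add[where p = p] y_def by simp
qed simp

text \<open>With \<open>s k x\<close> the product of \<open>c\<close> over the first
  \<open>k\<close> orbit points, the solution is \<open>s m x / s n x0\<close> for any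
  \<open>m\<close>, \<open>n\<close> at which the orbits of \<open>x\<close> and \<open>x0\<close>
  meet. At a fixed point of \<open>p\<close> the equation forces \<open>c x = 1\<close>, which
  \<open>periodic\<close> supplies.\<close>

lemma exists_unimodular_potential:
  fixes c :: "'a \<Rightarrow> complex"
  assumes closed: "\<And>x. x \<in> V \<Longrightarrow> p x \<in> V"
    and periodic: "\<And>x k. x \<in> V \<Longrightarrow> 0 < k \<Longrightarrow> (p ^^ k) x = x \<Longrightarrow> p x = x \<and> c x = 1"
    and "x0 \<in> V"
    and meet: "\<And>x. x \<in> V \<Longrightarrow> \<exists>m n. (p ^^ m) x = (p ^^ n) x0"
    and norm_c: "\<And>x. cmod (c x) = 1"
  shows "\<exists>b. (\<forall>x. cmod (b x) = 1) \<and> (\<forall>x\<in>V. b x = c x * b (p x))"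
proof -
  define s where "s k x = (\<Prod>i<k. c ((p ^^ i) x))" for k x
  have norm_s: "cmod (s k x) = 1" for k x
    by (simp add: s_def norm_c flip: prod_norm)
  then have s_nonzero: "s k x \<noteq> 0" for k x
    by (metis norm_zero zero_neq_one)
  have s_add: "s (m + n) x = s m x * s n ((p ^^ m) x)" for m n x
    unfolding s_def by (rule prod_orbit_add)
  have pow_add: "(p ^^ (m + n)) x = (p ^^ n) ((p ^^ m) x)" for m n x
    by (metis add.commute comp_apply funpow_add)
  have quotient: "s m x / s n x0 = s m' x / s n' x0"
    if "x \<in> V" "(p ^^ m) x = (p ^^ n) x0" "(p ^^ m') x = (p ^^ n') x0" for m n m' n' x
    using that
  proof (induction m m' arbitrary: n n' rule: linorder_wlog)
    case (le m m')
    obtain d where m': "m' = m + d"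
      using le(1) nat_le_iff_add by blast
    \<comment> \<open>Past the first meeting point the two orbits coincide, so \<open>d\<close>
      further steps multiply numerator and denominator by the same factor. The exponents
      \<open>n + d\<close> and \<open>n'\<close> may differ, but they reach the same point, so
      \<open>prod_orbit_eq\<close> identifies the two products.\<close>
    have "(p ^^ (n + d)) x0 = (p ^^ n') x0"
      using le m' by (metis pow_add)
    with closed periodic \<open>x0 \<in> V\<close> have "s (n + d) x0 = s n' x0"
      unfolding s_def by (rule prod_orbit_eq)
    then have "s n' x0 = s (n + d) x0" ..
    then show ?case
      by (simp add: m' s_add le(3) s_nonzero)
  next
    case (sym m m')
    then show ?case by metis
  qed
  define q where "q x = (SOME q. (p ^^ fst q) x = (p ^^ snd q) x0)" for x
  have q: "(p ^^ fst (q x)) x = (p ^^ snd (q x)) x0" if "x \<in> V" for x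
  proof -
    have "\<exists>q. (p ^^ fst q) x = (p ^^ snd q) x0"
      using meet[OF that] by simp
    then show ?thesis
      unfolding q_def by (rule someI_ex)
  qed
  define b where "b x = s (fst (q x)) x / s (snd (q x)) x0" for x
  have "b x = c x * b (p x)" if "x \<in> V" for x
  proof -
    let ?m = "fst (q (p x))" and ?n = "snd (q (p x))"
    \<comment> \<open>The pair chosen for \<open>p x\<close>, with one more step on the side of
      \<open>x\<close>, is a meeting pair for \<open>x\<close>; \<open>quotient\<close> lets it
      replace the pair chosen for \<open>x\<close>.\<close>
    have "(p ^^ Suc ?m) x = (p ^^ ?n) x0"
      using q[OF closed[OF that]] by (simp add: funpow_swap1)
    then have "b x = s (Suc ?m) x / s ?n x0"
      unfolding b_def using quotient[OF that q[OF that]] by blast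
    also have "s (Suc ?m) x = c x * s ?m (p x)"
      using s_add[of 1 ?m x] by (simp add: s_def)
    finally show ?thesis
      by (simp add: b_def)
  qed
  moreover have "cmod (b x) = 1" for x
    by (simp add: b_def norm_divide norm_s)
  ultimately show ?thesis
    by blast
qed

text \<open>Letting the root be its own parent makes the parent map total on \<open>V\<close>.\<close>

definition parent_or_root :: "'v set \<Rightarrow> ('v \<times> 'v) set \<Rightarrow> 'v \<Rightarrow> 'v" where
  "parent_or_root V E v = (if v \<in> nonroots V E then par V E v else v)"

section \<open>Ancestral lines in a directed tree\<close>

context directed_tree
begin

abbreviation "p \<equiv> parent_or_root V E"

lemma par_edge: "v \<in> nonroots V E \<Longrightarrow> par V E v \<in> V \<and> (par V E v, v) \<in> E"
  unfolding par_def by (rule theI', rule unique_parent) (auto simp: nonroots_def)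

lemma edge_parent:
  assumes "(u, v) \<in> E"
  shows "v \<in> nonroots V E" and "p v = u"
proof -
  have uv: "u \<in> V" "v \<in> V"
    using assms edges by auto
  then show v: "v \<in> nonroots V E"
    using assms by (auto simp: nonroots_def is_root_def)
  then have "par V E v = u"
    using par_edge[OF v] unique_parent[of v] uv assms by (auto simp: nonroots_def)
  with v show "p v = u"
    by (simp add: parent_or_root_def)
qed

lemma parent_closed: "v \<in> V \<Longrightarrow> p v \<in> V"
  using par_edge by (simp add: parent_or_root_def)

text \<open>Over one least period, the ancestral line of a periodic non-root would be a circuit.
  Hence only a root can be periodic, and there \<open>p\<close> is the identity.\<close>

lemma periodic_not_nonroot:
  assumes "x \<in> V" "0 < k" "(p ^^ k) x = x"
  shows "x \<notin> nonroots V E"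
proof
  assume x: "x \<in> nonroots V E"
  define n where "n = (LEAST n. 0 < n \<and> (p ^^ n) x = x)"
  have "0 < n \<and> (p ^^ n) x = x"
    unfolding n_def using assms(2,3) by (rule LeastI[of _ k, OF conjI])
  then have n: "0 < n" "(p ^^ n) x = x"
    by auto
  have minimal: "(p ^^ i) x \<noteq> x" if "0 < i" "i < n" for i
    using not_less_Least[of i "\<lambda>n. 0 < n \<and> (p ^^ n) x = x"] that by (auto simp: n_def)
  have in_V: "(p ^^ i) x \<in> V" for i
    using parent_closed assms(1) by (rule funpow_closed)
  have pow_add: "(p ^^ (i + j)) x = (p ^^ j) ((p ^^ i) x)" for i j
    by (metis add.commute comp_apply funpow_add)
  \<comment> \<open>A root on the orbit would be fixed by \<open>p\<close>; since the orbit comes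
    back to \<open>x\<close>, it would equal \<open>x\<close>.\<close>
  have nonroot: "(p ^^ i) x \<in> nonroots V E" if "i < n" for i
  proof (rule ccontr)
    assume root: "(p ^^ i) x \<notin> nonroots V E"
    then have "p ((p ^^ i) x) = (p ^^ i) x"
      by (simp add: parent_or_root_def)
    then have "(p ^^ (n - i)) ((p ^^ i) x) = (p ^^ i) x"
      by (rule funpow_fixed)
    then have "x = (p ^^ i) x"
      using pow_add[of i "n - i"] n that by simp
    with root x show False
      by simp
  qed
  have edge: "((p ^^ Suc i) x, (p ^^ i) x) \<in> E" if "i < n" for i
    using par_edge[OF nonroot[OF that]] nonroot[OF that] by (simp add: parent_or_root_def)
  \<comment> \<open>A circuit has at least two vertices, so period 1 is excluded separately: it
    would be a loop.\<close>
  have "n \<noteq> 1"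
  proof
    assume "n = 1"
    then have "(x, x) \<in> E"
      using edge[of 0] n by simp
    with edges assms(1) show False
      by auto
  qed
  have inj: "inj_on (\<lambda>i. (p ^^ i) x) {..<n}"
  proof (rule linorder_inj_onI)
    fix i j assume ij: "i < j" "i \<in> {..<n}" "j \<in> {..<n}"
    show "(p ^^ i) x \<noteq> (p ^^ j) x"
    proof
      assume "(p ^^ i) x = (p ^^ j) x"
      \<comment> \<open>Applying \<open>n - j\<close> more steps to both sides gives a return to
        \<open>x\<close> before the least period.\<close>
      then have "(p ^^ (i + (n - j))) x = x"
        using pow_add[of i "n - j"] pow_add[of j "n - j"] n ij by simp
      moreover have "0 < i + (n - j)" "i + (n - j) < n"
        using ij by auto
      ultimately show False
        using minimal[of "i + (n - j)"] by simp
    qed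
  qed auto
  \<comment> \<open>Edges run from parent to child, so the orbit is listed backwards, from
    \<open>(p ^^ (n - 1)) x\<close> down to \<open>x\<close>. The closing edge exists because
    \<open>x = (p ^^ n) x\<close> is the parent of the first entry.\<close>
  define us where "us = map (\<lambda>j. (p ^^ (n - Suc j)) x) [0..<n]"
  have len: "length us = n" and nth: "\<And>j. j < n \<Longrightarrow> us ! j = (p ^^ (n - Suc j)) x"
    by (auto simp: us_def)
  have ne: "us \<noteq> []"
    using n len by auto
  have "circuit V E us"
    unfolding circuit_def
  proof (intro conjI allI impI)
    show "2 \<le> length us"
      using len n \<open>n \<noteq> 1\<close> by simp
    show "set us \<subseteq> V"
      using in_V by (auto simp: us_def)
    show "distinct us"
      unfolding us_def distinct_map
      by (auto intro!: inj_onI dest!: inj_onD[OF inj])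
    show "(us ! j, us ! Suc j) \<in> E" if "Suc j < length us" for j
      using edge[of "n - Suc (Suc j)"] that len nth[of j] nth[of "Suc j"]
      by (metis Suc_diff_Suc Suc_lessD diff_less n(1) zero_less_Suc)
    have "last us = (p ^^ n) x"
      using ne len n nth[of "n - 1"] by (simp add: last_conv_nth)
    moreover have "hd us = (p ^^ (n - 1)) x"
      using ne n nth[of 0] by (simp add: hd_conv_nth)
    ultimately show "(last us, hd us) \<in> E"
      using edge[of "n - 1"] n(1) by simp
  qed
  with no_circuit show False
    by blast
qed

text \<open>Walk along an undirected path from \<open>u\<close> to \<open>v\<close>. A step to a
  child adds one iteration on the side of the path vertex, a step to a parent adds one on the side
  of \<open>u\<close>.\<close>

lemma common_ancestor:
  assumes "u \<in> V" "v \<in> V"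
  shows "\<exists>m n. (p ^^ m) u = (p ^^ n) v"
proof (cases "u = v")
  case False
  then obtain vs where "undirected_path V E u vs v"
    using connected assms by blast
  then have path: "vs \<noteq> []" "hd vs = u" "last vs = v"
    "\<And>j. Suc j < length vs \<Longrightarrow> (vs ! j, vs ! Suc j) \<in> E \<or> (vs ! Suc j, vs ! j) \<in> E"
    by (auto simp: undirected_path_def)
  have "\<exists>m n. (p ^^ m) u = (p ^^ n) (vs ! j)" if "j < length vs" for j
    using that
  proof (induction j)
    case 0
    show ?case
      using path by (metis hd_conv_nth)
  next
    case (Suc j)
    then obtain m n where mn: "(p ^^ m) u = (p ^^ n) (vs ! j)"
      by auto
    consider "p (vs ! Suc j) = vs ! j" | "p (vs ! j) = vs ! Suc j"
      using path(4)[OF Suc.prems] edge_parent(2) by blast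
    then show ?case
    proof cases
      case 1
      then have "(p ^^ m) u = (p ^^ Suc n) (vs ! Suc j)"
        by (simp add: mn funpow_swap1)
      then show ?thesis
        by blast
    next
      case 2
      then have "(p ^^ Suc m) u = (p ^^ n) (vs ! Suc j)"
        using mn by (simp add: funpow_swap1)
      then show ?thesis
        by blast
    qed
  qed
  from this[of "length vs - 1"] show ?thesis
    using path by (simp add: last_conv_nth)
qed blast

lemma exists_phase:
  "\<exists>b. (\<forall>v. cmod (b v) = 1) \<and>
    (\<forall>v\<in>nonroots V E. b v * w v = complex_of_real (cmod (w v)) * b (par V E v))"
proof -
  \<comment> \<open>The inverse phase of the weight. Since \<open>sgn 0 = 0\<close>, zero weights
    get the value 1 to keep \<open>c\<close> unimodular; the root gets 1 because \<open>p\<close>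
    fixes it.\<close>
  define c where "c v = (if v \<in> nonroots V E \<and> w v \<noteq> 0 then cnj (sgn (w v)) else 1)" for v
  have norm_c: "cmod (c v) = 1" for v
    by (simp add: c_def norm_sgn)
  have c_w: "c v * w v = complex_of_real (cmod (w v))" if "v \<in> nonroots V E" for v
  proof (cases "w v = 0")
    case False
    have "cnj (w v) * w v = complex_of_real (cmod (w v)) * complex_of_real (cmod (w v))"
      using complex_norm_square[of "w v"] by (simp add: power2_eq_square mult.commute)
    with False that show ?thesis
      by (simp add: c_def sgn_eq field_simps)
  qed simp
  obtain x0 where x0: "x0 \<in> V"
    using nonempty by blast
  have periodic: "p x = x \<and> c x = 1" if "x \<in> V" "0 < k" "(p ^^ k) x = x" for x k
    using periodic_not_nonroot[OF that] by (simp add: parent_or_root_def c_def)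
  have "\<exists>m n. (p ^^ m) x = (p ^^ n) x0" if "x \<in> V" for x
    using that x0 by (rule common_ancestor)
  with parent_closed periodic x0
  have "\<exists>b. (\<forall>x. cmod (b x) = 1) \<and> (\<forall>x\<in>V. b x = c x * b (p x))"
    using norm_c by (rule exists_unimodular_potential)
  then obtain b where b: "\<And>v. cmod (b v) = 1" "\<And>v. v \<in> V \<Longrightarrow> b v = c v * b (p v)"
    by blast
  have "b v * w v = complex_of_real (cmod (w v)) * b (par V E v)" if v: "v \<in> nonroots V E" for v
  proof -
    have "b v * w v = (c v * w v) * b (par V E v)"
      using b(2)[of v] v by (simp add: nonroots_def parent_or_root_def)
    with c_w[OF v] show ?thesis
      by simp
  qed
  with b(1) show ?thesis
    by blast
qed

end

section \<open>Multiplication by a unimodular function\<close>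

lemma unimodular_mult_ell2_iff:
  assumes "\<And>v. cmod (b v) = 1"
  shows "(\<lambda>v. b v * f v) \<in> ell2 V \<longleftrightarrow> f \<in> ell2 V"
proof -
  \<comment> \<open>Used for the support condition in \<open>ell2\<close>: the product vanishes at a
    point exactly when \<open>f\<close> does.\<close>
  have "b v \<noteq> 0" for v
    using assms[of v] by auto
  then show ?thesis
    by (simp add: ell2_def norm_mult assms)
qed

lemma unimodular_cancel:
  assumes "cmod z = 1"
  shows "z * cnj z = 1"
  using complex_norm_square[of z] assms by simp

lemma unitary_map_unimodular_mult:
  assumes b: "\<And>v. cmod (b v) = 1"
  shows "unitary_map V V (\<lambda>f v. b v * f v)"
proof -
  have "b v * cnj (b v) = 1" "cnj (b v) * b v = 1" for v
    using unimodular_cancel[OF b] by (simp_all add: mult.commute)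
  then have cancel: "b v * (cnj (b v) * z) = z" "cnj (b v) * (b v * z) = z" for v z
    by (simp_all flip: mult.assoc)
  \<comment> \<open>The inverse is multiplication by the conjugate of \<open>b\<close>.\<close>
  have "bij_betw (\<lambda>f v. b v * f v) (ell2 V) (ell2 V)"
    by (rule bij_betw_byWitness[where f' = "\<lambda>f v. cnj (b v) * f v"])
      (auto simp: cancel unimodular_mult_ell2_iff b)
  moreover have "ell2_inner V (\<lambda>v. b v * f v) (\<lambda>v. b v * g v) = ell2_inner V f g" for f g
  proof -
    have "b v * f v * cnj (b v * g v) = b v * (cnj (b v) * (f v * cnj (g v)))" for v
      by (simp add: mult_ac)
    then show ?thesis
      by (simp only: cancel ell2_inner_def)
  qed
  ultimately show ?thesis
    by (simp add: unitary_map_def distrib_left mult.left_commute)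
qed

theorem theorem3p2p1:
  fixes V :: "'v set" and E :: "('v \<times> 'v) set" and w :: "'v \<Rightarrow> complex"
  assumes "directed_tree V E"
  shows "unitarily_equivalent V (weighted_shift V E w)
           V (weighted_shift V E (\<lambda>v. complex_of_real (cmod (w v))))"
proof -
  interpret directed_tree V E
    by fact
  let ?a = "\<lambda>v. complex_of_real (cmod (w v))"
  obtain b where b: "\<And>v. cmod (b v) = 1"
    and phase: "\<And>v. v \<in> nonroots V E \<Longrightarrow> b v * w v = ?a v * b (par V E v)"
    using exists_phase by metis
  define U where "U f v = b v * f v" for f v
  have unitary: "unitary_map V V U"
    unfolding U_def using b by (rule unitary_map_unimodular_mult)
  have U_ell2: "U f \<in> ell2 V \<longleftrightarrow> f \<in> ell2 V" for f
    unfolding U_def using b by (rule unimodular_mult_ell2_iff)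
  \<comment> \<open>This holds for every function \<open>f\<close>, in the domain or not. Together
    with \<open>U_ell2\<close> it therefore also decides which \<open>U f\<close> lie in the domain
    of the second shift.\<close>
  have intertwine: "U (shift_map V E w f) = shift_map V E ?a (U f)" for f
  proof
    fix v
    show "U (shift_map V E w f) v = shift_map V E ?a (U f) v"
    proof (cases "v \<in> nonroots V E")
      case True
      have "b v * (w v * f (par V E v)) = ?a v * (b (par V E v) * f (par V E v))"
        using arg_cong[OF phase[OF True], of "\<lambda>z. z * f (par V E v)"] by (simp only: mult.assoc)
      with True show ?thesis
        by (simp add: U_def shift_map_def)
    qed (simp add: U_def shift_map_def)
  qed
  have image: "U ` ell2 V = ell2 V"
    using unitary by (simp add: unitary_map_def bij_betw_def)
  have "U ` {f \<in> ell2 V. shift_map V E w f \<in> ell2 V} =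
      {f \<in> ell2 V. shift_map V E ?a f \<in> ell2 V}" (is "U ` ?A = ?B")
  proof
    have mem: "U f \<in> ?B \<longleftrightarrow> f \<in> ?A" for f
      by (simp add: U_ell2 flip: intertwine)
    then show "U ` ?A \<subseteq> ?B"
      by blast
    have "?B \<subseteq> U ` ell2 V"
      using image by blast
    with mem show "?B \<subseteq> U ` ?A"
      by blast
  qed
  with unitary intertwine show ?thesis
    unfolding unitarily_equivalent_def weighted_shift_def by auto
qed

end
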